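(* Let $n\in\mathbb{N}$ and $s\in\mathbb{C}\setminus\{-1,-2,-3,\dots\}$. Then \begin{align*} &\sum_{k=1}^{n}\frac{(-1)^{k-1}}{k}\binom{s+n}{k}[\psi(s+n+1)-\psi(s+n-k+1)]\\ &=\sum_{k=0}^{n-1}\frac{(-1)^k\binom{s+k}{k}}{(k+1)^2\binom{n}{k+1}}+s\sum_{k=0}^{n-1}\frac{(-1)^k\binom{s+k}{k}}{(k+1)^2\binom{n}{k+1}}[\psi(s+k+1)-\psi(s+1)]. \end{align*}
   Context: $\psi=\Gamma'/\Gamma$ is the digamma function. For $z\in\mathbb{C}$ and $k\in\mathbb{N}_0$, $\binom{z}{k}=\frac{z(z-1)\cdots(z-k+1)}{k!}$. *)

theory Defs
  imports "HOL-Analysis.Analysis"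
begin

(* The library introduces Digamma as Polygamma 0, i.e. by a series. This lemma connects it to
   psi = Gamma' / Gamma, off the poles of Gamma. *)
lemma Digamma_eq_deriv_Gamma:
  fixes z :: complex
  assumes "z \<notin> \<int>\<^sub>\<le>\<^sub>0"
  shows "Digamma z = deriv Gamma z / Gamma z"
  using DERIV_imp_deriv[OF has_field_derivative_Gamma[OF assms]] assms
  by (simp add: Gamma_eq_zero_iff)

end

theory Submission
  imports Defs
begin

text \<open>
  Since \<open>\<psi>(z + 1) - \<psi>(z - k + 1)\<close> is the logarithmic derivative of \<open>z gchoose k\<close>, both sides of
  the identity are derivatives in \<open>s\<close>. It therefore suffices to show that the primitives
  \<open>\<Sum>k=1..n. (-1)^(k-1) / k * ((s + n) gchoose k)\<close> and
  \<open>s * (\<Sum>k<n. (-1)^k * ((s + k) gchoose k) / ((k + 1)\<^sup>2 * (n choose (k + 1))))\<close>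
  differ by a constant, which turns out to be the harmonic number \<open>harm n\<close>. Put \<open>x = -s\<close>. Both
  primitives can be compared by induction on \<open>n\<close>, since
  \<open>(-1)^j * ((s + j - 1) gchoose j) = x gchoose j\<close> and the increment of the second is a sum of
  ratios \<open>(x gchoose j) / (n choose j)\<close>, which telescopes.
\<close>

section \<open>Telescoping sums of binomial coefficients and their ratios\<close>

text \<open>The ratios \<open>t j\<close> satisfy
  \<open>(n - j) * t (j + 1) = (x - j) * t j\<close>, so
  \<open>(n + 1 - x) * t j = (n + 1 - j) * t j - (n - j) * t (j + 1)\<close> telescopes. The bound
  \<open>m \<le> n\<close> keeps all denominators nonzero.\<close>

lemma sum_gbinomial_divide_binomial:
  fixes x :: "'a :: field_char_0"
  assumes "m \<le> n"
  shows "(of_nat n + 1 - x) * (\<Sum>j<m. (x gchoose j) / of_nat (n choose j)) =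
           of_nat n + 1 - (of_nat n + 1 - of_nat m) * ((x gchoose m) / of_nat (n choose m))"
  using assms
proof (induction m)
  case 0
  then show ?case by simp
next
  case (Suc m)
  define t where "t j = (x gchoose j) / of_nat (n choose j)" for j
  define S where "S = (\<Sum>j<m. t j)"
  have bnz: "of_nat (n choose m) \<noteq> (0::'a)" "of_nat (n choose Suc m) \<noteq> (0::'a)"
    using Suc.prems by simp_all
  have "of_nat (Suc m) * of_nat (n choose Suc m) =
          (of_nat n - of_nat m :: 'a) * of_nat (n choose m)"
    using gbinomial_mult_1[of "of_nat n :: 'a" m]
    by (simp add: binomial_gbinomial algebra_simps)
  moreover have "of_nat (Suc m) * (x gchoose Suc m) = (x - of_nat m) * (x gchoose m)"
    using gbinomial_mult_1[of x m] by (simp add: algebra_simps)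
  moreover have "x gchoose m = t m * of_nat (n choose m)"
    "x gchoose Suc m = t (Suc m) * of_nat (n choose Suc m)"
    using bnz by (simp_all add: t_def)
  ultimately have "((of_nat n - of_nat m) * t (Suc m)) * of_nat (n choose m) =
                     ((x - of_nat m) * t m) * of_nat (n choose m)"
    by algebra
  hence "(of_nat n - of_nat m) * t (Suc m) = (x - of_nat m) * t m"
    using bnz by simp
  moreover have "(of_nat n + 1 - x) * S = of_nat n + 1 - (of_nat n + 1 - of_nat m) * t m"
    using Suc.IH Suc.prems by (simp add: S_def t_def)
  ultimately have "(of_nat n + 1 - x) * (S + t m) =
                     of_nat n + 1 - (of_nat n + 1 - (of_nat m + 1)) * t (Suc m)"
    by algebra
  thus ?case
    by (simp add: S_def t_def add.commute)
qed

lemma sum_gbinomial_divide_binomial_complete: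
  fixes x :: "'a :: field_char_0"
  shows "(of_nat n + 1 - x) * (\<Sum>j\<le>n. (x gchoose j) / of_nat (n choose j)) =
           (of_nat n + 1) * (1 - (x gchoose Suc n))"
proof -
  \<comment> \<open>The term \<open>j = n\<close> is added by hand: one more telescoping step would
    divide by \<open>n choose Suc n = 0\<close>.\<close>
  have "(of_nat n + 1) * (x gchoose Suc n) = (x - of_nat n) * (x gchoose n)"
    using gbinomial_mult_1[of x n] by (simp add: algebra_simps)
  moreover have "(of_nat n + 1 - x) * (\<Sum>j<n. (x gchoose j) / of_nat (n choose j)) =
                   of_nat n + 1 - (x gchoose n)"
    using sum_gbinomial_divide_binomial[of n n x] by simp
  moreover have "(\<Sum>j\<le>n. (x gchoose j) / of_nat (n choose j)) =
                   (\<Sum>j<n. (x gchoose j) / of_nat (n choose j)) + (x gchoose n)"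
    by (simp add: lessThan_Suc_atMost [symmetric])
  ultimately show ?thesis
    by algebra
qed

text \<open>Absorption turns \<open>y / k * ((y - 1) gchoose (k - 1))\<close> into
  \<open>y gchoose k\<close>; Pascal's rule splits this into two neighbours, which cancel in pairs
  under the alternating sign.\<close>

lemma sum_alternating_gbinomial_divide:
  fixes y :: "'a :: field_char_0"
  shows "y * (\<Sum>k=1..n. (-1) ^ (k - 1) / of_nat k * ((y - 1) gchoose (k - 1))) =
           1 - (-1) ^ n * ((y - 1) gchoose n)"
proof (induction n)
  case 0
  then show ?case by simp
next
  case (Suc n)
  have "of_nat (Suc n) * (y gchoose Suc n) = y * ((y - 1) gchoose n)"
    by (rule gbinomial_absorption)
  moreover have "y gchoose Suc n = ((y - 1) gchoose n) + ((y - 1) gchoose Suc n)"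
    using gbinomial_Suc_Suc[of "y - 1" n] by simp
  ultimately have "y * (((y - 1) gchoose n) / of_nat (Suc n)) =
                     ((y - 1) gchoose n) + ((y - 1) gchoose Suc n)"
    using of_nat_neq_0[of n, where 'a = 'a]
    by (simp add: field_simps del: of_nat_Suc)
  hence "y * ((-1) ^ n / of_nat (Suc n) * ((y - 1) gchoose n)) =
           (-1) ^ n * (((y - 1) gchoose n) + ((y - 1) gchoose Suc n))"
    by (simp add: mult_ac divide_inverse)
  with Suc.IH show ?case
    by (simp add: algebra_simps)
qed

section \<open>The finite identity with the harmonic number\<close>

text \<open>Passing from \<open>n\<close> to \<open>n + 1\<close>, both sums change by terms
  containing \<open>(1 - b) / y\<close>, with \<open>y\<close> and \<open>b\<close> as in the proof.
  These cancel and leave \<open>1 / (n + 1)\<close>, the increment of \<open>harm\<close>. The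
  assumption on \<open>x\<close> allows division by \<open>y\<close>.\<close>

lemma sum_alternating_gbinomial_eq_harm_diff:
  fixes x :: "'a :: real_normed_field"
  assumes "\<And>m. 1 \<le> m \<Longrightarrow> m \<le> n \<Longrightarrow> x \<noteq> of_nat m"
  shows "(\<Sum>k=1..n. (-1) ^ (k - 1) / of_nat k * ((of_nat n - x) gchoose k)) =
           harm n - (\<Sum>k=1..n. (x gchoose k) / (of_nat k * of_nat (n choose k)))"
  using assms
proof (induction n)
  case 0
  then show ?case by (simp add: harm_expand)
next
  case (Suc n)
  define y where "y = of_nat n + 1 - x"
  define b where "b = x gchoose Suc n"
  have "y \<noteq> 0"
    using Suc.prems[of "Suc n"] by (auto simp: y_def add.commute)
  have n1: "of_nat n + 1 \<noteq> (0::'a)"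
    using of_nat_neq_0[of n, where 'a = 'a] by (simp add: add.commute)
  have b: "(-1) ^ Suc n * ((y - 1) gchoose Suc n) = b"
    by (simp add: y_def b_def gbinomial_negated_upper[of x "Suc n"])
  have pascal: "y gchoose k = ((y - 1) gchoose (k - 1)) + ((y - 1) gchoose k)"
    if "k \<in> {1..Suc n}" for k
    using that gbinomial_Suc_Suc[of "y - 1" "k - 1"] by simp
  have "(\<Sum>k=1..Suc n. (-1) ^ (k - 1) / of_nat k * (y gchoose k)) =
          (\<Sum>k=1..Suc n. (-1) ^ (k - 1) / of_nat k * ((y - 1) gchoose (k - 1))) +
          (\<Sum>k=1..Suc n. (-1) ^ (k - 1) / of_nat k * ((y - 1) gchoose k))"
    by (subst sum.distrib [symmetric], rule sum.cong) (simp_all add: pascal distrib_left)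
  also have "(\<Sum>k=1..Suc n. (-1) ^ (k - 1) / of_nat k * ((y - 1) gchoose (k - 1))) = (1 - b) / y"
    using sum_alternating_gbinomial_divide[of y "Suc n"] \<open>y \<noteq> 0\<close>
    unfolding b by (simp add: field_simps)
  \<comment> \<open>Since \<open>y - 1 = n - x\<close>, the terms up to \<open>n\<close> are the
    induction hypothesis; the term \<open>k = n + 1\<close> gives
    \<open>- b / (n + 1)\<close>.\<close>
  also have "(\<Sum>k=1..Suc n. (-1) ^ (k - 1) / of_nat k * ((y - 1) gchoose k)) =
               harm n - (\<Sum>k=1..n. (x gchoose k) / (of_nat k * of_nat (n choose k))) -
               b / (of_nat n + 1)"
  proof -
    have "(-1) ^ n / of_nat (Suc n) * ((y - 1) gchoose Suc n) = - (b / (of_nat n + 1))"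
      unfolding b [symmetric] by (simp add: add.commute)
    thus ?thesis
      using Suc.IH Suc.prems by (simp add: y_def)
  qed
  finally have lhs: "(\<Sum>k=1..Suc n. (-1) ^ (k - 1) / of_nat k * (y gchoose k)) =
      (1 - b) / y + (harm n - (\<Sum>k=1..n. (x gchoose k) / (of_nat k * of_nat (n choose k))) -
               b / (of_nat n + 1))" .
  \<comment> \<open>From \<open>1 / (Suc n choose k) = (n + 1 - k) / ((n + 1) * (n choose
    k))\<close>; the part with \<open>- k\<close> loses its factor \<open>1 / k\<close> and so
    yields the ratio sum evaluated earlier.\<close>
  have step: "(x gchoose k) / (of_nat k * of_nat (Suc n choose k)) =
                (x gchoose k) / (of_nat k * of_nat (n choose k)) -
                (x gchoose k) / of_nat (n choose k) / (of_nat n + 1)"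
    if k: "k \<in> {1..n}" for k
  proof -
    have nz: "of_nat k \<noteq> (0::'a)" "of_nat (n choose k) \<noteq> (0::'a)"
      "of_nat (Suc n choose k) \<noteq> (0::'a)"
      using k by simp_all
    have "(of_nat n + 1 - of_nat k) * of_nat (Suc n choose k) =
            (of_nat n + 1) * (of_nat (n choose k) :: 'a)"
    proof -
      have "(Suc n - k) * (Suc n choose k) = Suc n * (n choose k)"
        using binomial_absorb_comp[of "Suc n" k] by simp
      hence "of_nat (Suc n - k) * of_nat (Suc n choose k) =
               (of_nat (Suc n) * of_nat (n choose k) :: 'a)"
        by (metis of_nat_mult)
      thus ?thesis using k by (simp add: of_nat_diff add.commute)
    qed
    hence "1 / of_nat (Suc n choose k) =
             (of_nat n + 1 - of_nat k) / ((of_nat n + 1) * of_nat (n choose k) :: 'a)"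
      using nz n1 by (simp add: divide_simps mult_ac)
    hence "(x gchoose k) / of_nat k * (1 / of_nat (Suc n choose k)) = (x gchoose k) / of_nat k *
             ((of_nat n + 1 - of_nat k) / ((of_nat n + 1) * of_nat (n choose k)))"
      by simp
    also have "\<dots> = (x gchoose k) / (of_nat k * of_nat (n choose k)) -
                (x gchoose k) / of_nat (n choose k) / (of_nat n + 1)"
      using nz n1 by (simp add: divide_simps) (simp add: algebra_simps)
    finally show ?thesis by simp
  qed
  have "(\<Sum>k=1..Suc n. (x gchoose k) / (of_nat k * of_nat (Suc n choose k))) =
          (\<Sum>k=1..n. (x gchoose k) / (of_nat k * of_nat (n choose k))) -
          (\<Sum>k=1..n. (x gchoose k) / of_nat (n choose k)) / (of_nat n + 1) + b / (of_nat n + 1)"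
    using step by (simp add: b_def sum_subtractf sum_divide_distrib add.commute)
  also have "(\<Sum>k=1..n. (x gchoose k) / of_nat (n choose k)) =
               (\<Sum>k\<le>n. (x gchoose k) / of_nat (n choose k)) - 1"
    by (simp add: atMost_atLeast0 sum.atLeast_Suc_atMost)
  also have "(\<Sum>k\<le>n. (x gchoose k) / of_nat (n choose k)) = (of_nat n + 1) * (1 - b) / y"
    using sum_gbinomial_divide_binomial_complete[of n x] \<open>y \<noteq> 0\<close>
    by (simp add: y_def b_def field_simps)
  finally have rhs: "(\<Sum>k=1..Suc n. (x gchoose k) / (of_nat k * of_nat (Suc n choose k))) =
      (\<Sum>k=1..n. (x gchoose k) / (of_nat k * of_nat (n choose k))) -
      ((of_nat n + 1) * (1 - b) / y - 1) / (of_nat n + 1) + b / (of_nat n + 1)" .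
  have "((of_nat n + 1) * (1 - b) / y - 1) / (of_nat n + 1) = (1 - b) / y - 1 / (of_nat n + 1)"
    using n1 by (simp add: diff_divide_distrib)
  with lhs rhs have "(\<Sum>k=1..Suc n. (-1) ^ (k - 1) / of_nat k * (y gchoose k)) =
      harm n + 1 / (of_nat n + 1) -
      (\<Sum>k=1..Suc n. (x gchoose k) / (of_nat k * of_nat (Suc n choose k)))"
    by simp
  thus ?case
    by (simp add: y_def harm_Suc inverse_eq_divide add.commute)
qed

section \<open>Differentiation of generalized binomial coefficients\<close>

text \<open>Each new factor \<open>z - k\<close> adds \<open>1 / (z - k)\<close> to the logarithmic
  derivative, which is \<open>Digamma (z - k + 1) - Digamma (z - k)\<close>. The assumption keeps
  these factors nonzero.\<close>

lemma has_field_derivative_gbinomial: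
  fixes z :: complex
  assumes "\<And>i. i < k \<Longrightarrow> z \<noteq> of_nat i"
  shows "((\<lambda>z. z gchoose k) has_field_derivative
           (z gchoose k) * (Digamma (z + 1) - Digamma (z - of_nat k + 1))) (at z)"
  using assms
proof (induction k)
  case 0
  then show ?case by simp
next
  case (Suc k)
  have rec: "w gchoose Suc k = (w gchoose k) * (w - of_nat k) / of_nat (Suc k)" for w :: complex
    using gbinomial_absorb_comp[of w k] gbinomial_absorption[of k w]
      of_nat_neq_0[of k, where 'a = complex]
    by (simp add: mult.commute eq_divide_eq del: of_nat_Suc)
  have nz: "z - of_nat k \<noteq> 0"
    using Suc.prems[of k] by simp
  have "Digamma (z - of_nat k + 1) = Digamma (z - of_nat k) + 1 / (z - of_nat k)"
    using Digamma_plus1[OF nz] .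
  moreover have "z - of_nat (Suc k) + 1 = z - of_nat k"
    by simp
  moreover have "((\<lambda>z. z gchoose k) has_field_derivative
      (z gchoose k) * (Digamma (z + 1) - Digamma (z - of_nat k + 1))) (at z)"
    using Suc.prems by (intro Suc.IH) simp
  ultimately show ?case
    unfolding rec using nz of_nat_neq_0[of k, where 'a = complex]
    by (auto intro!: derivative_eq_intros simp del: of_nat_Suc) (simp add: field_simps)
qed

section \<open>The two primitives and their derivatives\<close>

lemma primitives_differ_by_harm:
  fixes s :: "'a :: real_normed_field"
  assumes "\<And>m::nat. m \<ge> 1 \<Longrightarrow> s \<noteq> - of_nat m"
  shows "(\<Sum>k=1..n. (-1) ^ (k - 1) / of_nat k * ((s + of_nat n) gchoose k)) =
           harm n + s * (\<Sum>k<n. (-1) ^ k * ((s + of_nat k) gchoose k) /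
             ((of_nat k + 1)\<^sup>2 * (of_nat n gchoose (k + 1))))"
proof -
  \<comment> \<open>Negating the upper index gives the sign. Absorption then extracts
    \<open>s / (k + 1)\<close>, the source of both the factor \<open>s\<close> and the
    square.\<close>
  have summand: "((- s) gchoose Suc k) / (of_nat (Suc k) * of_nat (n choose Suc k)) =
          - (s * ((-1) ^ k * ((s + of_nat k) gchoose k) /
             ((of_nat k + 1)\<^sup>2 * (of_nat n gchoose (k + 1)))))" for k
  proof -
    have k1: "of_nat k + 1 \<noteq> (0::'a)"
      using of_nat_neq_0[of k, where 'a = 'a] by (simp add: add.commute)
    have "(- s) gchoose Suc k = (-1) ^ Suc k * ((s + of_nat k) gchoose Suc k)"
      using gbinomial_negated_upper[of "-s" "Suc k"] by (simp add: add.commute)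
    moreover have "(of_nat k + 1) * ((s + of_nat k) gchoose Suc k) = s * ((s + of_nat k) gchoose k)"
      using gbinomial_mult_1[of "s + of_nat k" k] by (simp add: algebra_simps)
    hence "(s + of_nat k) gchoose Suc k = s * ((s + of_nat k) gchoose k) / (of_nat k + 1)"
      using k1 by (simp add: field_simps)
    ultimately show ?thesis
      by (simp add: binomial_gbinomial power2_eq_square add.commute mult_ac)
  qed
  have "(\<Sum>k=1..n. (-1) ^ (k - 1) / of_nat k * ((of_nat n - (- s)) gchoose k)) =
          harm n - (\<Sum>k=1..n. ((- s) gchoose k) / (of_nat k * of_nat (n choose k)))"
    using assms by (intro sum_alternating_gbinomial_eq_harm_diff) (metis minus_minus)
  also have "(\<Sum>k=1..n. ((- s) gchoose k) / (of_nat k * of_nat (n choose k))) =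
          (\<Sum>k<n. ((- s) gchoose Suc k) / (of_nat (Suc k) * of_nat (n choose Suc k)))"
    by (simp add: sum.atLeast1_atMost_eq)
  finally show ?thesis
    unfolding summand by (simp add: sum_negf sum_distrib_left add.commute)
qed

theorem theorem2p7:
  fixes n :: nat and s :: complex
  assumes "n \<ge> 1"
    and "\<And>m::nat. m \<ge> 1 \<Longrightarrow> s \<noteq> - of_nat m"
  shows "(\<Sum>k=1..n. (-1) ^ (k - 1) / of_nat k * ((s + of_nat n) gchoose k) *
            (Digamma (s + of_nat n + 1) - Digamma (s + of_nat n - of_nat k + 1)))
       = (\<Sum>k=0..n-1. (-1) ^ k * ((s + of_nat k) gchoose k) /
            ((of_nat k + 1)\<^sup>2 * (of_nat n gchoose (k + 1))))
         + s * (\<Sum>k=0..n-1. (-1) ^ k * ((s + of_nat k) gchoose k) /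
            ((of_nat k + 1)\<^sup>2 * (of_nat n gchoose (k + 1))) *
            (Digamma (s + of_nat k + 1) - Digamma (s + 1)))"
    (is "?L = ?A + s * ?B")
proof -
  define f g :: "complex \<Rightarrow> complex" where
    "f = (\<lambda>z. \<Sum>k=1..n. (-1) ^ (k - 1) / of_nat k * ((z + of_nat n) gchoose k))" and
    "g = (\<lambda>z. \<Sum>k<n. (-1) ^ k * ((z + of_nat k) gchoose k) /
             ((of_nat k + 1)\<^sup>2 * (of_nat n gchoose (k + 1))))"
  define S :: "complex set" where "S = (\<lambda>z. z + 1) -` (- \<int>\<^sub>\<le>\<^sub>0)"
  \<comment> \<open>Used with \<open>m = n\<close> for \<open>f\<close> and with
    \<open>m = k\<close> for \<open>g\<close>; the latter produces \<open>Digamma (s + 1)\<close>. A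
    vanishing factor would force \<open>s = - (m - i)\<close> with \<open>m - i \<ge> 1\<close>,
    which is excluded.\<close>
  have deriv: "((\<lambda>z. (z + of_nat m) gchoose k) has_field_derivative ((s + of_nat m) gchoose k) *
                 (Digamma (s + of_nat m + 1) - Digamma (s + of_nat m - of_nat k + 1))) (at s)"
    if "k \<le> m" for k m
  proof -
    have "s + of_nat m \<noteq> of_nat i" if "i < k" for i
    proof
      assume "s + of_nat m = of_nat i"
      hence "s = - of_nat (m - i)"
        using that \<open>k \<le> m\<close> by (simp add: of_nat_diff algebra_simps)
      thus False
        using assms(2)[of "m - i"] that \<open>k \<le> m\<close> by linarith
    qed
    hence "((\<lambda>z. z gchoose k) has_field_derivative ((s + of_nat m) gchoose k) *
             (Digamma (s + of_nat m + 1) - Digamma (s + of_nat m - of_nat k + 1))) (at (s + of_nat m))"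
      by (rule has_field_derivative_gbinomial)
    thus ?thesis
      by (simp add: DERIV_shift)
  qed
  have f': "(f has_field_derivative ?L) (at s)"
    unfolding f_def by (rule DERIV_sum) (auto intro!: derivative_eq_intros deriv)
  \<comment> \<open>Truncated subtraction makes this false for \<open>n = 0\<close>.\<close>
  have idx: "{..<n} = {0..n-1}"
    using assms(1) by auto
  have g': "(g has_field_derivative ?B) (at s)"
    unfolding g_def idx
  proof (rule DERIV_sum)
    fix k
    show "((\<lambda>z. (-1) ^ k * ((z + of_nat k) gchoose k) /
               ((of_nat k + 1)\<^sup>2 * (of_nat n gchoose (k + 1)))) has_field_derivative
            (-1) ^ k * ((s + of_nat k) gchoose k) /
               ((of_nat k + 1)\<^sup>2 * (of_nat n gchoose (k + 1))) *
            (Digamma (s + of_nat k + 1) - Digamma (s + 1))) (at s)"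
      using DERIV_cmult[OF deriv[of k k], of "(-1) ^ k /
               ((of_nat k + 1)\<^sup>2 * (of_nat n gchoose (k + 1)))"]
      by (simp add: mult_ac)
  qed
  \<comment> \<open>The primitives must agree on a whole neighbourhood of \<open>s\<close> for their
    derivatives to be compared.\<close>
  have "open S"
    unfolding S_def
    by (intro open_vimage continuous_intros open_Compl closed_nonpos_Ints)
  have S_iff: "z \<in> S \<longleftrightarrow> (\<forall>m::nat\<ge>1. z \<noteq> - of_nat m)" for z
  proof -
    have "z + 1 \<in> \<int>\<^sub>\<le>\<^sub>0 \<longleftrightarrow> (\<exists>m::nat\<ge>1. z = - of_nat m)"
    proof
      assume "z + 1 \<in> \<int>\<^sub>\<le>\<^sub>0"
      then obtain k where "z + 1 = - of_nat k"
        by (elim nonpos_Ints_cases')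
      hence "z = - of_nat (Suc k)"
        using eq_diff_eq[of z "- of_nat k" 1] by simp
      thus "\<exists>m::nat\<ge>1. z = - of_nat m"
        by (intro exI[of _ "Suc k"]) auto
    next
      assume "\<exists>m::nat\<ge>1. z = - of_nat m"
      then obtain m :: nat where "m \<ge> 1" "z = - of_nat m"
        by blast
      hence "z + 1 = - of_nat (m - 1)"
        by (simp add: of_nat_diff)
      thus "z + 1 \<in> \<int>\<^sub>\<le>\<^sub>0"
        by simp
    qed
    thus ?thesis
      by (auto simp: S_def)
  qed
  \<comment> \<open>The product rule accounts for the two sums on the right-hand side, and the
    harmonic constant disappears.\<close>
  have "((\<lambda>z. harm n + z * g z) has_field_derivative g s + s * ?B) (at s)"
    by (auto intro!: derivative_eq_intros g')
  moreover have "s \<in> S"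
    using assms(2) by (simp add: S_iff)
  moreover have "harm n + z * g z = f z" if "z \<in> S" for z
    unfolding f_def g_def
    by (rule primitives_differ_by_harm [symmetric]) (use that S_iff in blast)
  ultimately have "(f has_field_derivative g s + s * ?B) (at s)"
    using has_field_derivative_transform_within_open[OF _ \<open>open S\<close>] by blast
  from DERIV_unique[OF f' this] show ?thesis
    by (simp only: g_def idx)
qed

end
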